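(* Let $\{E_\lambda:\lambda\in\Lambda\}$ be a family of real Banach spaces each of which is a local-GL-space, and let $E=[\bigoplus_{\lambda\in\Lambda}E_\lambda]_{l_\infty}$. Then $E$ is a local-GL-space.
   Context: All spaces are over the real field. $B_E$, $S_E$, $E^*$ denote the closed unit ball, the unit sphere and the dual of $E$. $[\bigoplus_{\lambda\in\Lambda}E_\lambda]_{l_\infty}$ is the $l_\infty$-sum: bounded families $(x_\lambda)$ with $x_\lambda\in E_\lambda$ and norm $\sup_\lambda\|x_\lambda\|$. A Banach space $E$ is a GL-space (generalized-lush space) if for every $x\in S_E$ and every $\varepsilon>0$ there is $x^*\in S_{E^*}$ such that, with $S=S(x^*,\varepsilon)=\{z\in B_E: x^*(z)>1-\varepsilon\}$, one has $x\in S$ and $\mathrm{dist}(y,S)+\mathrm{dist}(y,-S)<2+\varepsilon$ for all $y\in S_E$. A Banach space $E$ is a local-GL-space if for every separable subspace $X\subset E$ there is a (closed) subspace $Y$ of $E$ which is a GL-space (with the inherited norm) and satisfies $X\subset Y\subset E$. *)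

theory Defs
  imports "HOL-Analysis.Analysis" "HOL-Library.Function_Algebras"
begin

instantiation "fun" :: (type, real_vector) real_vector
begin

definition scaleR_fun :: "real \<Rightarrow> ('a \<Rightarrow> 'b) \<Rightarrow> 'a \<Rightarrow> 'b"
  where "scaleR_fun c f = (\<lambda>i. c *\<^sub>R f i)"

instance
  by standard
    (simp_all add: scaleR_fun_def fun_eq_iff scaleR_add_right scaleR_add_left)

end

text \<open>
  A normed space is a pair of a carrier \<open>E\<close>, a linear subspace of some real vector
  space, and a function \<open>N\<close> that is a norm on \<open>E\<close>; nothing is assumed about \<open>N\<close> outside
  \<open>E\<close>, and the ambient vector space carries no topology. The members of a family of normed
  spaces share the ambient vector space (as they may: take the algebraic direct sum) but
  each has its own norm, unrelated to the others.
\<close>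

locale normed_space_on =
  fixes E :: "'a::real_vector set" and N :: "'a \<Rightarrow> real"
  assumes subspace_carrier: "subspace E"
    and norm_eq_zero_iff: "x \<in> E \<Longrightarrow> N x = 0 \<longleftrightarrow> x = 0"
    and norm_triangle: "x \<in> E \<Longrightarrow> y \<in> E \<Longrightarrow> N (x + y) \<le> N x + N y"
    and norm_scale: "x \<in> E \<Longrightarrow> N (c *\<^sub>R x) = \<bar>c\<bar> * N x"

text \<open>
  The value \<open>0\<close> off the carrier is only there because the locale \<^locale>\<open>Metric_space\<close> demands
  nonnegativity and symmetry on the whole type.
\<close>

definition norm_dist :: "'a::real_vector set \<Rightarrow> ('a \<Rightarrow> real) \<Rightarrow> 'a \<Rightarrow> 'a \<Rightarrow> real"
  where "norm_dist E N x y = (if x \<in> E \<and> y \<in> E then N (x - y) else 0)"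

definition norm_topology :: "'a::real_vector set \<Rightarrow> ('a \<Rightarrow> real) \<Rightarrow> 'a topology"
  where "norm_topology E N = Metric_space.mtopology E (norm_dist E N)"

locale banach_space_on = normed_space_on +
  assumes complete_carrier: "Metric_space.mcomplete E (norm_dist E N)"

definition unit_ball :: "'a::real_vector set \<Rightarrow> ('a \<Rightarrow> real) \<Rightarrow> 'a set"
  where "unit_ball E N = {x \<in> E. N x \<le> 1}"

definition unit_sphere :: "'a::real_vector set \<Rightarrow> ('a \<Rightarrow> real) \<Rightarrow> 'a set"
  where "unit_sphere E N = {x \<in> E. N x = 1}"

text \<open>
  A functional on \<open>E\<close> is represented by its extension by \<open>0\<close> to the ambient type, so that
  distinct elements of the dual are distinct functionals on \<open>E\<close>.
\<close>

definition dual_space :: "'a::real_vector set \<Rightarrow> ('a \<Rightarrow> real) \<Rightarrow> ('a \<Rightarrow> real) set"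
  where "dual_space E N =
    {f. (\<forall>x\<in>E. \<forall>y\<in>E. f (x + y) = f x + f y) \<and>
        (\<forall>c. \<forall>x\<in>E. f (c *\<^sub>R x) = c * f x) \<and>
        (\<forall>x. x \<notin> E \<longrightarrow> f x = 0) \<and>
        bdd_above ((\<lambda>x. \<bar>f x\<bar>) ` unit_ball E N)}"

definition dual_norm :: "'a::real_vector set \<Rightarrow> ('a \<Rightarrow> real) \<Rightarrow> ('a \<Rightarrow> real) \<Rightarrow> real"
  where "dual_norm E N f = (SUP x\<in>unit_ball E N. \<bar>f x\<bar>)"

definition slice :: "'a::real_vector set \<Rightarrow> ('a \<Rightarrow> real) \<Rightarrow> ('a \<Rightarrow> real) \<Rightarrow> real \<Rightarrow> 'a set"
  where "slice E N f \<epsilon> = {z \<in> unit_ball E N. f z > 1 - \<epsilon>}"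

text \<open>Only meaningful for nonempty \<open>S\<close>; in \<open>GL_space\<close> below the slice contains \<open>x\<close>.\<close>

definition set_dist :: "('a::real_vector \<Rightarrow> real) \<Rightarrow> 'a \<Rightarrow> 'a set \<Rightarrow> real"
  where "set_dist N y S = (INF s\<in>S. N (y - s))"

definition GL_space :: "'a::real_vector set \<Rightarrow> ('a \<Rightarrow> real) \<Rightarrow> bool"
  where "GL_space E N \<longleftrightarrow>
    banach_space_on E N \<and>
    (\<forall>x\<in>unit_sphere E N. \<forall>\<epsilon>>0.
       \<exists>f\<in>unit_sphere (dual_space E N) (dual_norm E N).
         x \<in> slice E N f \<epsilon> \<and>
         (\<forall>y\<in>unit_sphere E N.
            set_dist N y (slice E N f \<epsilon>) + set_dist N y (uminus ` slice E N f \<epsilon>) < 2 + \<epsilon>))"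

definition local_GL_space :: "'a::real_vector set \<Rightarrow> ('a \<Rightarrow> real) \<Rightarrow> bool"
  where "local_GL_space E N \<longleftrightarrow>
    banach_space_on E N \<and>
    (\<forall>X. subspace X \<and> X \<subseteq> E \<and> separable_space (subtopology (norm_topology E N) X) \<longrightarrow>
       (\<exists>Y. subspace Y \<and> closedin (norm_topology E N) Y \<and> GL_space Y N \<and> X \<subseteq> Y \<and> Y \<subseteq> E))"

text \<open>
  Families over \<open>I\<close> are functions that vanish outside \<open>I\<close>, so that two elements of the sum
  are equal as soon as they agree on \<open>I\<close>. The empty sum is the zero space; its norm needs a
  separate clause because the supremum of the empty set of reals is unspecified.
\<close>

definition linf_sum ::
    "'i set \<Rightarrow> ('i \<Rightarrow> 'a::real_vector set) \<Rightarrow> ('i \<Rightarrow> 'a \<Rightarrow> real) \<Rightarrow> ('i \<Rightarrow> 'a) set"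
  where "linf_sum I E N =
    {x. (\<forall>i\<in>I. x i \<in> E i) \<and> (\<forall>i. i \<notin> I \<longrightarrow> x i = 0) \<and> bdd_above ((\<lambda>i. N i (x i)) ` I)}"

definition linf_norm :: "'i set \<Rightarrow> ('i \<Rightarrow> 'a \<Rightarrow> real) \<Rightarrow> ('i \<Rightarrow> 'a) \<Rightarrow> real"
  where "linf_norm I N x = (if I = {} then 0 else SUP i\<in>I. N i (x i))"

end

theory Submission
  imports Defs
begin

text \<open>
  The coordinate projections of a separable subspace are separable, hence lie in GL-subspaces
  \<open>Y\<^sub>i\<close> of the summands, and it suffices that the \<open>l\<^sub>\<infinity>\<close>-sum of GL-spaces is a GL-space. Given \<open>x\<close>
  on its sphere, choose a coordinate \<open>i\<close> with \<open>\<parallel>x\<^sub>i\<parallel>\<close> nearly \<open>1\<close> and compose with the \<open>i\<close>-th projection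
  a functional that works for \<open>x\<^sub>i / \<parallel>x\<^sub>i\<parallel>\<close>. The resulting slice constrains only the \<open>i\<close>-th
  coordinate, so both distances of a point \<open>y\<close> are governed by \<open>y\<^sub>i\<close>, which may lie inside the ball
  rather than on the sphere.
\<close>

lemma scaleR_fun_apply: "(c *\<^sub>R f) i = c *\<^sub>R f i"
  by (simp add: scaleR_fun_def)

section \<open>Norms on a carrier: metric, limits and completeness\<close>

context normed_space_on
begin

lemma norm_zero: "N 0 = 0"
  by (simp add: norm_eq_zero_iff subspace_0[OF subspace_carrier])

lemma norm_uminus: "x \<in> E \<Longrightarrow> N (- x) = N x"
  using norm_scale[of x "- 1"] by simp

lemma norm_minus_commute: "x \<in> E \<Longrightarrow> y \<in> E \<Longrightarrow> N (x - y) = N (y - x)"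
  using norm_uminus[of "x - y"] subspace_diff[OF subspace_carrier] by simp

lemma norm_nonneg: "x \<in> E \<Longrightarrow> 0 \<le> N x"
  using norm_triangle[of x "- x"] norm_uminus[of x] norm_zero subspace_neg[OF subspace_carrier, of x]
  by simp

lemma norm_dist_triangle:
  assumes "x \<in> E" "y \<in> E" "z \<in> E"
  shows "N (x - z) \<le> N (x - y) + N (y - z)"
  using norm_triangle[of "x - y" "y - z"] assms subspace_diff[OF subspace_carrier] by simp

lemma Metric_space_norm_dist: "Metric_space E (norm_dist E N)"
proof
  show "0 \<le> norm_dist E N x y" for x y
    using norm_nonneg subspace_diff[OF subspace_carrier] by (simp add: norm_dist_def)
  show "norm_dist E N x y = norm_dist E N y x" for x y
    using norm_minus_commute by (simp add: norm_dist_def)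
  show "norm_dist E N x y = 0 \<longleftrightarrow> x = y" if "x \<in> E" "y \<in> E" for x y
    using that norm_eq_zero_iff[of "x - y"] subspace_diff[OF subspace_carrier]
    by (simp add: norm_dist_def)
  show "norm_dist E N x z \<le> norm_dist E N x y + norm_dist E N y z"
    if "x \<in> E" "y \<in> E" "z \<in> E" for x y z
    using that norm_dist_triangle by (simp add: norm_dist_def)
qed

lemma topspace_norm_topology: "topspace (norm_topology E N) = E"
  by (simp add: norm_topology_def Metric_space.topspace_mtopology[OF Metric_space_norm_dist])

lemma limitin_norm_topology_iff:
  assumes "range \<sigma> \<subseteq> E"
  shows "limitin (norm_topology E N) \<sigma> l sequentially \<longleftrightarrow>
    l \<in> E \<and> (\<forall>\<epsilon>>0. \<exists>M. \<forall>n\<ge>M. N (\<sigma> n - l) < \<epsilon>)"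
  using assms
  by (auto simp: norm_topology_def Metric_space.limitin_metric[OF Metric_space_norm_dist]
      eventually_sequentially norm_dist_def range_subsetD)

lemma MCauchy_norm_dist_iff:
  "Metric_space.MCauchy E (norm_dist E N) \<sigma> \<longleftrightarrow>
    range \<sigma> \<subseteq> E \<and> (\<forall>\<epsilon>>0. \<exists>M. \<forall>m\<ge>M. \<forall>n\<ge>M. N (\<sigma> m - \<sigma> n) < \<epsilon>)"
  unfolding Metric_space.MCauchy_def[OF Metric_space_norm_dist] norm_dist_def
  by (intro conj_cong refl) (simp add: range_subsetD imp_conjL)

text \<open>Expresses completeness through \<open>N\<close> alone: all points compared lie in
  \<open>E\<close>, so the default value of \<open>norm_dist\<close> drops out. In this form
  completeness passes easily between a sum and its coordinates, or from a subspace to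
  closedness.\<close>

lemma banach_space_on_iff:
  "banach_space_on E N \<longleftrightarrow>
    (\<forall>\<sigma> :: nat \<Rightarrow> 'a. range \<sigma> \<subseteq> E \<longrightarrow> (\<forall>\<epsilon>>0. \<exists>M. \<forall>m\<ge>M. \<forall>n\<ge>M. N (\<sigma> m - \<sigma> n) < \<epsilon>) \<longrightarrow>
      (\<exists>l\<in>E. \<forall>\<epsilon>>0. \<exists>M. \<forall>n\<ge>M. N (\<sigma> n - l) < \<epsilon>))"
  (is "_ \<longleftrightarrow> ?rhs")
proof -
  have "banach_space_on E N \<longleftrightarrow> Metric_space.mcomplete E (norm_dist E N)"
    using normed_space_on_axioms by (simp add: banach_space_on_def banach_space_on_axioms_def)
  also have "\<dots> \<longleftrightarrow> (\<forall>\<sigma>. range \<sigma> \<subseteq> E \<longrightarrow> (\<forall>\<epsilon>>0. \<exists>M. \<forall>m\<ge>M. \<forall>n\<ge>M. N (\<sigma> m - \<sigma> n) < \<epsilon>) \<longrightarrow>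
      (\<exists>l. limitin (norm_topology E N) \<sigma> l sequentially))"
    unfolding Metric_space.mcomplete_def[OF Metric_space_norm_dist] MCauchy_norm_dist_iff
      norm_topology_def by blast
  also have "\<dots> \<longleftrightarrow> ?rhs"
    by (rule all_cong1, rule imp_cong[OF refl]) (simp add: limitin_norm_topology_iff Bex_def)
  finally show ?thesis .
qed

text \<open>A sequence in \<open>Y\<close> that converges in \<open>E\<close> is Cauchy, hence has a
  limit in \<open>Y\<close> by completeness, and limits are unique. This supplies the closedness
  clause of \<open>local_GL_space\<close>.\<close>

lemma complete_subspace_closedin:
  assumes "banach_space_on Y N" "Y \<subseteq> E"
  shows "closedin (norm_topology E N) Y"
proof -
  interpret Y: banach_space_on Y N by fact
  have "l \<in> Y" if \<sigma>: "range \<sigma> \<subseteq> Y" and lim: "limitin (norm_topology E N) \<sigma> l sequentially" for \<sigma> l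
  proof -
    have \<sigma>E: "range \<sigma> \<subseteq> E"
      using \<sigma> \<open>Y \<subseteq> E\<close> by blast
    have "Metric_space.MCauchy E (norm_dist E N) \<sigma>"
      using Metric_space.convergent_imp_MCauchy[OF Metric_space_norm_dist \<sigma>E] lim
      by (simp add: norm_topology_def)
    then have "\<forall>\<epsilon>>0. \<exists>M. \<forall>m\<ge>M. \<forall>n\<ge>M. N (\<sigma> m - \<sigma> n) < \<epsilon>"
      by (simp add: MCauchy_norm_dist_iff)
    then obtain l' where "l' \<in> Y" and l': "\<forall>\<epsilon>>0. \<exists>M. \<forall>n\<ge>M. N (\<sigma> n - l') < \<epsilon>"
      using iffD1[OF Y.banach_space_on_iff assms(1), rule_format, of \<sigma>] \<sigma> by blast
    then have "limitin (norm_topology E N) \<sigma> l' sequentially"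
      using limitin_norm_topology_iff[OF \<sigma>E] \<open>Y \<subseteq> E\<close> by (simp add: subsetD)
    then have "l = l'"
      using lim Metric_space.limitin_metric_unique[OF Metric_space_norm_dist, of \<sigma> l sequentially l']
      by (simp add: norm_topology_def)
    then show ?thesis
      using \<open>l' \<in> Y\<close> by simp
  qed
  then show ?thesis
    using \<open>Y \<subseteq> E\<close> unfolding norm_topology_def
      Metric_space.metric_closedin_iff_sequentially_closed[OF Metric_space_norm_dist]
    by blast
qed

section \<open>Distances to a slice and to its reflection\<close>

text \<open>The infima need not be attained, but a strict inequality leaves room for
  near-minimizers. A point of the reflected set is \<open>- t\<close> with \<open>t \<in> S\<close>,
  whence the term \<open>N (y + t)\<close>.\<close>

lemma set_dist_sum_less_iff:
  assumes "S \<subseteq> E" "S \<noteq> {}" "y \<in> E"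
  shows "set_dist N y S + set_dist N y (uminus ` S) < c \<longleftrightarrow>
    (\<exists>s\<in>S. \<exists>t\<in>S. N (y - s) + N (y + t) < c)"
proof
  have "(\<lambda>s. N (y - s)) ` S \<subseteq> {0..}" "(\<lambda>t. N (y + t)) ` S \<subseteq> {0..}"
    using assms norm_nonneg subspace_diff[OF subspace_carrier] subspace_add[OF subspace_carrier]
    by auto
  then have bdd: "bdd_below ((\<lambda>s. N (y - s)) ` S)" "bdd_below ((\<lambda>t. N (y + t)) ` S)"
    using bdd_below_mono bdd_below_Ici by metis+
  have neg: "set_dist N y (uminus ` S) = (INF t\<in>S. N (y + t))"
    by (simp add: set_dist_def image_comp)
  show "\<exists>s\<in>S. \<exists>t\<in>S. N (y - s) + N (y + t) < c"
    if less: "set_dist N y S + set_dist N y (uminus ` S) < c"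
  proof -
    \<comment> \<open>Half of the slack: each infimum may be exceeded by less than \<open>r\<close>
      and the sum still stays below \<open>c\<close>.\<close>
    define r where "r = (c - set_dist N y S - set_dist N y (uminus ` S)) / 2"
    have "r > 0"
      using less by (simp add: r_def)
    then have "(INF s\<in>S. N (y - s)) < set_dist N y S + r"
      "(INF t\<in>S. N (y + t)) < set_dist N y (uminus ` S) + r"
      unfolding neg by (simp_all add: set_dist_def)
    then obtain s t where "s \<in> S" "N (y - s) < set_dist N y S + r"
      "t \<in> S" "N (y + t) < set_dist N y (uminus ` S) + r"
      using cINF_less_iff[OF \<open>S \<noteq> {}\<close> bdd(1)] cINF_less_iff[OF \<open>S \<noteq> {}\<close> bdd(2)] by blast
    moreover have "set_dist N y S + r + (set_dist N y (uminus ` S) + r) = c"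
      by (simp add: r_def field_simps)
    ultimately show ?thesis
      by (intro bexI[of _ s] bexI[of _ t]) linarith+
  qed
  show "set_dist N y S + set_dist N y (uminus ` S) < c"
    if witnesses: "\<exists>s\<in>S. \<exists>t\<in>S. N (y - s) + N (y + t) < c"
  proof -
    obtain s t where "s \<in> S" "t \<in> S" "N (y - s) + N (y + t) < c"
      using witnesses by blast
    moreover have "set_dist N y S \<le> N (y - s)"
      using cINF_lower[OF bdd(1) \<open>s \<in> S\<close>] by (simp add: set_dist_def)
    moreover have "set_dist N y (uminus ` S) \<le> N (y + t)"
      using cINF_lower[OF bdd(2) \<open>t \<in> S\<close>] by (simp add: neg)
    ultimately show ?thesis
      by linarith
  qed
qed

text \<open>A slice is the intersection of the unit ball with an open half-space, and both are
  convex.\<close>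

lemma convex_combination_in_slice:
  assumes f: "f \<in> dual_space E N" and "s \<in> slice E N f \<epsilon>" "t \<in> slice E N f \<epsilon>"
    and "0 \<le> a" "0 \<le> b" "a + b = 1"
  shows "a *\<^sub>R s + b *\<^sub>R t \<in> slice E N f \<epsilon>"
proof -
  have st: "s \<in> E" "t \<in> E" "N s \<le> 1" "N t \<le> 1" "f s > 1 - \<epsilon>" "f t > 1 - \<epsilon>"
    using assms by (auto simp: slice_def unit_ball_def)
  then have E: "a *\<^sub>R s \<in> E" "b *\<^sub>R t \<in> E"
    using subspace_scale[OF subspace_carrier] by auto
  have "N (a *\<^sub>R s + b *\<^sub>R t) \<le> a * N s + b * N t"
    using norm_triangle[OF E] norm_scale st assms by simp
  also have "\<dots> \<le> 1"
    using convex_bound_le[of "N s" 1 "N t" a b] st assms by simp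
  finally have "a *\<^sub>R s + b *\<^sub>R t \<in> unit_ball E N"
    using E subspace_add[OF subspace_carrier] by (simp add: unit_ball_def)
  moreover have "f (a *\<^sub>R s + b *\<^sub>R t) = a * f s + b * f t"
    using f E st by (simp add: dual_space_def)
  moreover have "a * f s + b * f t > 1 - \<epsilon>"
    using convex_bound_lt[of "- f s" "\<epsilon> - 1" "- f t" a b] st assms by simp
  ultimately show ?thesis
    by (simp add: slice_def)
qed

text \<open>
  Both distance functions are convex, and reflection in the origin interchanges them, so their
  sum on the segment from \<open>-u\<close> to \<open>u\<close> is largest at the ends.
\<close>

lemma slice_witnesses_on_ball:
  assumes f: "f \<in> dual_space E N" and "x \<in> unit_sphere E N"
    and sphere: "\<And>u. u \<in> unit_sphere E N \<Longrightarrow>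
      \<exists>s\<in>slice E N f \<epsilon>. \<exists>t\<in>slice E N f \<epsilon>. N (u - s) + N (u + t) < c"
    and "y \<in> unit_ball E N"
  shows "\<exists>s\<in>slice E N f \<epsilon>. \<exists>t\<in>slice E N f \<epsilon>. N (y - s) + N (y + t) < c"
proof -
  have y: "y \<in> E" "N y \<le> 1"
    using assms by (auto simp: unit_ball_def)
  obtain u where u: "u \<in> unit_sphere E N" "y = N y *\<^sub>R u"
  \<comment> \<open>Normalizing \<open>y\<close> gives \<open>u\<close>; the zero vector has no
    direction, and there the given unit vector \<open>x\<close> serves.\<close>
  proof (cases "y = 0")
    case True
    then show ?thesis
      using that[of x] assms norm_zero by simp
  next
    case False
    then have "N y > 0"
      using norm_eq_zero_iff norm_nonneg y by (metis less_eq_real_def)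
    then show ?thesis
      using that[of "inverse (N y) *\<^sub>R y"] y norm_scale subspace_scale[OF subspace_carrier]
      by (simp add: unit_sphere_def)
  qed
  obtain s t where st: "s \<in> slice E N f \<epsilon>" "t \<in> slice E N f \<epsilon>" "N (u - s) + N (u + t) < c"
    using sphere[OF u(1)] by blast
  \<comment> \<open>The solution of \<open>a + b = 1\<close> and \<open>a - b = N y\<close>, so that
    \<open>y\<close> is the convex combination of \<open>u\<close> and \<open>- u\<close> with
    weights \<open>a\<close> and \<open>b\<close>.\<close>
  define a b where "a = (1 + N y) / 2" and "b = (1 - N y) / 2"
  have ab: "0 \<le> a" "0 \<le> b" "a + b = 1" "a - b = N y"
    using norm_nonneg y by (auto simp: a_def b_def field_simps)
  have "u \<in> E" "s \<in> E" "t \<in> E"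
    using u st by (auto simp: unit_sphere_def slice_def unit_ball_def)
  then have us: "u - s \<in> E" and ut: "u + t \<in> E"
    using subspace_diff[OF subspace_carrier] subspace_add[OF subspace_carrier] by auto
  have comb: "N (p *\<^sub>R v + q *\<^sub>R w) \<le> p * N v + q * N w"
    if "v \<in> E" "w \<in> E" "0 \<le> p" "0 \<le> q" for v w p q
    using norm_triangle[of "p *\<^sub>R v" "q *\<^sub>R w"] norm_scale that subspace_scale[OF subspace_carrier]
    by simp
  have yu: "y = a *\<^sub>R u - b *\<^sub>R u"
    using u(2) ab(4) by (metis scaleR_diff_left)
  \<comment> \<open>At \<open>- u\<close> the witnesses \<open>s\<close> and \<open>t\<close>
    exchange roles. Hence \<open>y\<close> is approximated by \<open>s\<close> and \<open>t\<close>
    with weights \<open>a\<close> and \<open>b\<close>, and \<open>- y\<close> by the same points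
    with the weights swapped.\<close>
  have "y - (a *\<^sub>R s + b *\<^sub>R t) = a *\<^sub>R (u - s) + b *\<^sub>R - (u + t)"
    by (simp add: yu algebra_simps)
  then have 1: "N (y - (a *\<^sub>R s + b *\<^sub>R t)) \<le> a * N (u - s) + b * N (u + t)"
    using comb[OF us subspace_neg[OF subspace_carrier ut] ab(1,2)] norm_uminus[OF ut] by simp
  have "y + (a *\<^sub>R t + b *\<^sub>R s) = a *\<^sub>R (u + t) + b *\<^sub>R - (u - s)"
    by (simp add: yu algebra_simps)
  then have 2: "N (y + (a *\<^sub>R t + b *\<^sub>R s)) \<le> a * N (u + t) + b * N (u - s)"
    using comb[OF ut subspace_neg[OF subspace_carrier us] ab(1,2)] norm_uminus[OF us] by simp
  \<comment> \<open>Because of the swap, each norm at \<open>u\<close> occurs once with weight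
    \<open>a\<close> and once with weight \<open>b\<close>, so nothing is lost.\<close>
  have "a * N (u - s) + b * N (u + t) + (a * N (u + t) + b * N (u - s)) =
      (a + b) * (N (u - s) + N (u + t))"
    by (simp add: algebra_simps)
  then have "N (y - (a *\<^sub>R s + b *\<^sub>R t)) + N (y + (a *\<^sub>R t + b *\<^sub>R s)) < c"
    using 1 2 st(3) ab(3) by simp
  then show ?thesis
    using convex_combination_in_slice[OF f st(1,2) ab(1,2,3)]
      convex_combination_in_slice[OF f st(2,1) ab(1,2,3)] by blast
qed

end

text \<open>The slice contains \<open>x\<close>, so it is nonempty and
  \<open>set_dist_sum_less_iff\<close> applies. Afterwards only witnesses are handled, no distance
  infima.\<close>

lemma GL_space_iff:
  "GL_space E N \<longleftrightarrow> banach_space_on E N \<and>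
    (\<forall>x\<in>unit_sphere E N. \<forall>\<epsilon>>0. \<exists>f\<in>unit_sphere (dual_space E N) (dual_norm E N).
      x \<in> slice E N f \<epsilon> \<and>
      (\<forall>y\<in>unit_sphere E N. \<exists>s\<in>slice E N f \<epsilon>. \<exists>t\<in>slice E N f \<epsilon>. N (y - s) + N (y + t) < 2 + \<epsilon>))"
proof (cases "banach_space_on E N")
  case True
  then interpret banach_space_on E N .
  have "set_dist N y (slice E N f \<epsilon>) + set_dist N y (uminus ` slice E N f \<epsilon>) < 2 + \<epsilon> \<longleftrightarrow>
      (\<exists>s\<in>slice E N f \<epsilon>. \<exists>t\<in>slice E N f \<epsilon>. N (y - s) + N (y + t) < 2 + \<epsilon>)"
    if "x \<in> slice E N f \<epsilon>" "y \<in> unit_sphere E N" for x y f \<epsilon>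
    using that by (intro set_dist_sum_less_iff) (auto simp: slice_def unit_ball_def unit_sphere_def)
  then show ?thesis
    unfolding GL_space_def by (simp cong: conj_cong)
next
  case False
  then show ?thesis
    by (simp add: GL_space_def)
qed

section \<open>The sum of Banach spaces is a Banach space\<close>

lemma linf_sum_component: "x \<in> linf_sum I E N \<Longrightarrow> i \<in> I \<Longrightarrow> x i \<in> E i"
  by (simp add: linf_sum_def)

lemma component_le_linf_norm: "x \<in> linf_sum I E N \<Longrightarrow> i \<in> I \<Longrightarrow> N i (x i) \<le> linf_norm I N x"
  by (auto simp: linf_sum_def linf_norm_def intro: cSUP_upper)

lemma linf_norm_le:
  assumes "0 \<le> c" "\<And>i. i \<in> I \<Longrightarrow> N i (x i) \<le> c"
  shows "linf_norm I N x \<le> c"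
  using assms by (auto simp: linf_norm_def intro: cSUP_least)

lemma linf_sumI:
  assumes "\<And>i. i \<in> I \<Longrightarrow> x i \<in> E i" "\<And>i. i \<notin> I \<Longrightarrow> x i = 0" "\<And>i. i \<in> I \<Longrightarrow> N i (x i) \<le> c"
  shows "x \<in> linf_sum I E N"
  using assms by (auto simp: linf_sum_def bdd_above_def)

lemma normed_space_on_linf_sum:
  assumes "\<And>i. i \<in> I \<Longrightarrow> normed_space_on (E i) (N i)"
  shows "normed_space_on (linf_sum I E N) (linf_norm I N)"
proof
  note normed = normed_space_on.subspace_carrier[OF assms] normed_space_on.norm_triangle[OF assms]
    normed_space_on.norm_scale[OF assms] normed_space_on.norm_zero[OF assms]
    normed_space_on.norm_nonneg[OF assms]
  \<comment> \<open>\<open>linf_norm_le\<close> asks for a nonnegative bound, since that is what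
    covers the empty family.\<close>
  have nonneg: "0 \<le> linf_norm I N x" if "x \<in> linf_sum I E N" for x
  proof (cases "I = {}")
    case False
    then obtain i where "i \<in> I"
      by blast
    then show ?thesis
      using component_le_linf_norm[OF that] normed(5) linf_sum_component[OF that]
      by (meson order_trans)
  qed (simp add: linf_norm_def)
  have add: "N i (x i + y i) \<le> linf_norm I N x + linf_norm I N y"
    if "x \<in> linf_sum I E N" "y \<in> linf_sum I E N" "i \<in> I" for x y i
    using normed(2)[of i "x i" "y i"] that linf_sum_component
      component_le_linf_norm[OF that(1,3)] component_le_linf_norm[OF that(2,3)] by fastforce
  have scale_le: "N i (c *\<^sub>R x i) \<le> \<bar>c\<bar> * linf_norm I N x"
    if "x \<in> linf_sum I E N" "i \<in> I" for c x i
    using normed(3)[of i "x i"] that linf_sum_component[OF that] component_le_linf_norm[OF that]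
    by (simp add: mult_left_mono)
  show sub: "subspace (linf_sum I E N)"
  proof (rule subspaceI)
    show "0 \<in> linf_sum I E N"
      using normed(1,4) by (intro linf_sumI[where c = 0]) (auto simp: subspace_0)
    show "x + y \<in> linf_sum I E N" if "x \<in> linf_sum I E N" "y \<in> linf_sum I E N" for x y
      using that add[OF that] normed(1) linf_sum_component[OF that(1)] linf_sum_component[OF that(2)]
      by (intro linf_sumI[where c = "linf_norm I N x + linf_norm I N y"])
        (auto simp: subspace_add linf_sum_def)
    show "c *\<^sub>R x \<in> linf_sum I E N" if "x \<in> linf_sum I E N" for c x
      using that scale_le[OF that] normed(1) linf_sum_component[OF that]
      by (intro linf_sumI[where c = "\<bar>c\<bar> * linf_norm I N x"])
        (auto simp: subspace_scale linf_sum_def scaleR_fun_apply)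
  qed
  show "linf_norm I N (x + y) \<le> linf_norm I N x + linf_norm I N y"
    if "x \<in> linf_sum I E N" "y \<in> linf_sum I E N" for x y
    using add[OF that] nonneg that by (intro linf_norm_le) auto
  have scale: "linf_norm I N (c *\<^sub>R x) \<le> \<bar>c\<bar> * linf_norm I N x" if "x \<in> linf_sum I E N" for c x
    using scale_le[OF that] nonneg[OF that] by (intro linf_norm_le) (auto simp: scaleR_fun_apply)
  show zero_iff: "linf_norm I N x = 0 \<longleftrightarrow> x = 0" if x: "x \<in> linf_sum I E N" for x
  proof
    assume "linf_norm I N x = 0"
    then have "N i (x i) = 0" if "i \<in> I" for i
      using that component_le_linf_norm[OF x that] normed(5)[OF that linf_sum_component[OF x that]]
      by linarith
    then have "x i = 0" for i
      using x normed_space_on.norm_eq_zero_iff[OF assms] by (cases "i \<in> I") (auto simp: linf_sum_def)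
    then show "x = 0"
      by (simp add: fun_eq_iff)
  next
    assume "x = 0"
    then show "linf_norm I N x = 0"
      using normed(4) by (simp add: linf_norm_def)
  qed
  show "linf_norm I N (c *\<^sub>R x) = \<bar>c\<bar> * linf_norm I N x" if x: "x \<in> linf_sum I E N" for c x
  proof (cases "c = 0")
    case True
    then show ?thesis
      using zero_iff[OF subspace_0[OF sub]] by simp
  next
    case False
    \<comment> \<open>Applying the upper estimate to \<open>inverse c\<close> and
      \<open>c *\<^sub>R x\<close> reverses it.\<close>
    have "linf_norm I N x \<le> \<bar>inverse c\<bar> * linf_norm I N (c *\<^sub>R x)"
      using scale[OF subspace_scale[OF sub x], of "inverse c" c] False by simp
    then have "\<bar>c\<bar> * linf_norm I N x \<le> linf_norm I N (c *\<^sub>R x)"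
      using False by (simp add: field_simps)
    then show ?thesis
      using scale[OF x, of c] by simp
  qed
qed

text \<open>The limit is taken in each coordinate. The Cauchy bound is the same for all coordinates,
  which makes the convergence uniform and keeps the limit family bounded.\<close>

lemma banach_space_on_linf_sum:
  assumes "\<And>i. i \<in> I \<Longrightarrow> banach_space_on (E i) (N i)"
  shows "banach_space_on (linf_sum I E N) (linf_norm I N)"
proof -
  let ?L = "linf_sum I E N" and ?N = "linf_norm I N"
  have normed: "normed_space_on (E i) (N i)" if "i \<in> I" for i
    using assms[OF that] by (simp add: banach_space_on_def)
  interpret L: normed_space_on ?L ?N
    using normed_space_on_linf_sum normed by blast
  have "\<exists>l\<in>?L. \<forall>\<epsilon>>0. \<exists>M. \<forall>n\<ge>M. ?N (\<sigma> n - l) < \<epsilon>"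
    if \<sigma>: "range \<sigma> \<subseteq> ?L" and Cauchy: "\<forall>\<epsilon>>0. \<exists>M. \<forall>m\<ge>M. \<forall>n\<ge>M. ?N (\<sigma> m - \<sigma> n) < \<epsilon>"
    for \<sigma> :: "nat \<Rightarrow> 'a \<Rightarrow> 'b"
  proof -
    have \<sigma>L: "\<sigma> n \<in> ?L" for n
      using \<sigma> by blast
    have \<sigma>E: "\<sigma> n i \<in> E i" if "i \<in> I" for n i
      using linf_sum_component[OF \<sigma>L that] .
    have le: "N i (\<sigma> m i - \<sigma> n i) \<le> ?N (\<sigma> m - \<sigma> n)" if "i \<in> I" for i m n
      using component_le_linf_norm[OF subspace_diff[OF L.subspace_carrier \<sigma>L \<sigma>L] that]
      by simp
    have "\<exists>l\<in>E i. \<forall>\<epsilon>>0. \<exists>M. \<forall>n\<ge>M. N i (\<sigma> n i - l) < \<epsilon>" if i: "i \<in> I" for i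
    proof -
      have "\<forall>\<epsilon>>0. \<exists>M. \<forall>m\<ge>M. \<forall>n\<ge>M. N i (\<sigma> m i - \<sigma> n i) < \<epsilon>"
        using Cauchy le[OF i] by (meson le_less_trans)
      moreover have "range (\<lambda>n. \<sigma> n i) \<subseteq> E i"
        using \<sigma>E[OF i] by blast
      ultimately show ?thesis
        using assms[OF i] unfolding normed_space_on.banach_space_on_iff[OF normed[OF i]] by blast
    qed
    then obtain l where lE: "\<And>i. i \<in> I \<Longrightarrow> l i \<in> E i"
      and lim: "\<And>i \<epsilon>. i \<in> I \<Longrightarrow> \<epsilon> > 0 \<Longrightarrow> \<exists>M. \<forall>n\<ge>M. N i (\<sigma> n i - l i) < \<epsilon>"
      by metis
    \<comment> \<open>Members of the sum vanish outside \<open>I\<close>, whereas the chosen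
      \<open>l\<close> is arbitrary there.\<close>
    define l' where "l' i = (if i \<in> I then l i else 0)" for i
    have unif: "\<exists>M. \<forall>n\<ge>M. \<forall>i\<in>I. N i (\<sigma> n i - l' i) \<le> \<epsilon>" if "\<epsilon> > 0" for \<epsilon> :: real
    proof -
      obtain M where M: "\<forall>m\<ge>M. \<forall>n\<ge>M. ?N (\<sigma> m - \<sigma> n) < \<epsilon>"
        using Cauchy \<open>\<epsilon> > 0\<close> by blast
      have "N i (\<sigma> n i - l' i) \<le> \<epsilon>" if "n \<ge> M" "i \<in> I" for n i
      proof (rule field_le_epsilon)
        fix e :: real assume "e > 0"
        then obtain K where K: "\<forall>n\<ge>K. N i (\<sigma> n i - l i) < e"
          using lim \<open>i \<in> I\<close> by blast
        \<comment> \<open>The index \<open>m\<close> may depend on \<open>i\<close> and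
          \<open>e\<close>, but the bound on \<open>N i (\<sigma> n i - \<sigma> m i)\<close>
          depends on neither; as \<open>e\<close> is arbitrary, the estimate becomes uniform in
          \<open>i\<close>.\<close>
        define m where "m = max M K"
        have "N i (\<sigma> n i - l i) \<le> N i (\<sigma> n i - \<sigma> m i) + N i (\<sigma> m i - l i)"
          using normed_space_on.norm_dist_triangle[OF normed] \<sigma>E lE \<open>i \<in> I\<close> by blast
        moreover have "N i (\<sigma> n i - \<sigma> m i) < \<epsilon>"
          using M le[OF \<open>i \<in> I\<close>] \<open>n \<ge> M\<close> by (metis le_less_trans m_def max.cobounded1)
        moreover have "N i (\<sigma> m i - l i) < e"
          using K by (simp add: m_def)
        ultimately show "N i (\<sigma> n i - l' i) \<le> \<epsilon> + e"
          using \<open>i \<in> I\<close> by (simp add: l'_def)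
      qed
      then show ?thesis
        by blast
    qed
    obtain M where M: "\<forall>n\<ge>M. \<forall>i\<in>I. N i (\<sigma> n i - l' i) \<le> 1"
      using unif[of 1] by auto
    \<comment> \<open>Boundedness of \<open>l'\<close> is obtained indirectly: it differs from the
      member \<open>\<sigma> M\<close> by a family bounded by \<open>1\<close>.\<close>
    have "\<sigma> M - l' \<in> ?L"
      using M \<sigma>L[of M] subspace_diff[OF normed_space_on.subspace_carrier[OF normed]] \<sigma>E lE
      by (intro linf_sumI[where c = 1]) (auto simp: l'_def linf_sum_def)
    then have "\<sigma> M - (\<sigma> M - l') \<in> ?L"
      using subspace_diff[OF L.subspace_carrier \<sigma>L] by blast
    moreover have "\<sigma> M - (\<sigma> M - l') = l'"
      by simp
    ultimately have "l' \<in> ?L"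
      by simp
    moreover have "\<exists>M. \<forall>n\<ge>M. ?N (\<sigma> n - l') < \<epsilon>" if "\<epsilon> > 0" for \<epsilon>
    proof -
      \<comment> \<open>Half of \<open>\<epsilon>\<close>, because a supremum of coordinates only
        preserves weak inequalities.\<close>
      obtain M where M: "\<forall>n\<ge>M. \<forall>i\<in>I. N i (\<sigma> n i - l' i) \<le> \<epsilon> / 2"
        using unif[of "\<epsilon> / 2"] \<open>\<epsilon> > 0\<close> by auto
      have "?N (\<sigma> n - l') \<le> \<epsilon> / 2" if "n \<ge> M" for n
        using M that \<open>\<epsilon> > 0\<close> by (intro linf_norm_le) auto
      then show ?thesis
        using \<open>\<epsilon> > 0\<close> by (intro exI[of _ M]) fastforce
    qed
    ultimately show ?thesis
      by blast
  qed
  then show ?thesis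
    using L.banach_space_on_iff by blast
qed

section \<open>The sum of GL-spaces is a GL-space\<close>

text \<open>The projection maps the unit ball of the sum onto that of \<open>E i\<close>. So both
  functionals take the same absolute values on their unit balls, which transfers boundedness and the
  norm at once.\<close>

lemma coordinate_functional:
  assumes normed: "\<And>i. i \<in> I \<Longrightarrow> normed_space_on (E i) (N i)" and i: "i \<in> I"
    and f: "f \<in> dual_space (E i) (N i)"
  defines "g \<equiv> \<lambda>x. if x \<in> linf_sum I E N then f (x i) else 0"
  shows "g \<in> dual_space (linf_sum I E N) (linf_norm I N)"
    and "dual_norm (linf_sum I E N) (linf_norm I N) g = dual_norm (E i) (N i) f"
proof -
  let ?L = "linf_sum I E N" and ?N = "linf_norm I N"
  interpret L: normed_space_on ?L ?N
    using normed_space_on_linf_sum normed by blast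
  have image: "(\<lambda>x. \<bar>g x\<bar>) ` unit_ball ?L ?N = (\<lambda>x. \<bar>f x\<bar>) ` unit_ball (E i) (N i)"
  proof (intro equalityI image_subsetI)
    fix x assume x: "x \<in> unit_ball ?L ?N"
    then have "x i \<in> unit_ball (E i) (N i)"
      using component_le_linf_norm[of x I E N i] linf_sum_component[of x I E N i] i
      by (auto simp: unit_ball_def)
    then show "\<bar>g x\<bar> \<in> (\<lambda>x. \<bar>f x\<bar>) ` unit_ball (E i) (N i)"
      using x by (auto simp: g_def unit_ball_def)
  next
    fix y assume "y \<in> unit_ball (E i) (N i)"
    then have y: "y \<in> E i" "N i y \<le> 1"
      by (auto simp: unit_ball_def)
    \<comment> \<open>A preimage of \<open>y\<close> in the unit ball: \<open>y\<close> in
      coordinate \<open>i\<close>, zero elsewhere.\<close>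
    define x where "x = (\<lambda>j. if j = i then y else 0)"
    have le: "N j (x j) \<le> 1" if "j \<in> I" for j
      using that y normed_space_on.norm_zero[OF normed] by (auto simp: x_def)
    have "x \<in> ?L"
      using y le i normed_space_on.subspace_carrier[OF normed]
      by (intro linf_sumI[where c = 1]) (auto simp: x_def subspace_0)
    moreover have "?N x \<le> 1"
      using le by (intro linf_norm_le) auto
    ultimately show "\<bar>f y\<bar> \<in> (\<lambda>x. \<bar>g x\<bar>) ` unit_ball ?L ?N"
      by (intro image_eqI[of _ _ x]) (auto simp: g_def unit_ball_def x_def)
  qed
  show "dual_norm ?L ?N g = dual_norm (E i) (N i) f"
    by (simp add: dual_norm_def image)
  show "g \<in> dual_space ?L ?N"
    using f i image L.subspace_carrier
    by (auto simp: dual_space_def g_def subspace_add subspace_scale linf_sum_component scaleR_fun_apply)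
qed

lemma GL_space_linf_sum:
  assumes GL: "\<And>i. i \<in> I \<Longrightarrow> GL_space (E i) (N i)"
  shows "GL_space (linf_sum I E N) (linf_norm I N)"
proof -
  let ?L = "linf_sum I E N" and ?N = "linf_norm I N"
  have banach: "banach_space_on (E i) (N i)" if "i \<in> I" for i
    using GL[OF that] by (simp add: GL_space_def)
  then have normed: "normed_space_on (E i) (N i)" if "i \<in> I" for i
    using that by (simp add: banach_space_on_def)
  interpret L: banach_space_on ?L ?N
    using banach_space_on_linf_sum banach by blast
  have "\<exists>g\<in>unit_sphere (dual_space ?L ?N) (dual_norm ?L ?N). x \<in> slice ?L ?N g \<epsilon> \<and>
      (\<forall>y\<in>unit_sphere ?L ?N. \<exists>s\<in>slice ?L ?N g \<epsilon>. \<exists>t\<in>slice ?L ?N g \<epsilon>. ?N (y - s) + ?N (y + t) < 2 + \<epsilon>)"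
    if "x \<in> unit_sphere ?L ?N" and "\<epsilon> > 0" for x \<epsilon>
  proof -
    have x: "x \<in> ?L" "?N x = 1"
      using that by (auto simp: unit_sphere_def)
    \<comment> \<open>The norm of the empty sum is \<open>0\<close>, so its unit sphere is
      empty.\<close>
    then have "I \<noteq> {}"
      by (auto simp: linf_norm_def)
    \<comment> \<open>Chosen so that
      \<open>(1 - \<delta>) * (1 - \<delta>) \<ge> 1 - \<epsilon>\<close>; one factor is lost in the
      norm of \<open>x i\<close>, the other in the value of \<open>f\<close> at \<open>u\<close>.
      The bound \<open>1 / 2\<close> keeps \<open>x i\<close> away from zero.\<close>
    define \<delta> where "\<delta> = min (\<epsilon> / 2) (1 / 2)"
    have \<delta>: "0 < \<delta>" "\<delta> \<le> \<epsilon>" "\<delta> < 1" "2 * \<delta> \<le> \<epsilon>"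
      using \<open>\<epsilon> > 0\<close> by (auto simp: \<delta>_def)
    have "1 - \<delta> < (SUP i\<in>I. N i (x i))"
      using x \<open>I \<noteq> {}\<close> \<delta> by (simp add: linf_norm_def)
    then obtain i where i: "i \<in> I" and xi: "1 - \<delta> < N i (x i)"
      using x(1) \<open>I \<noteq> {}\<close> by (auto simp: linf_sum_def less_cSUP_iff)
    interpret Ei: banach_space_on "E i" "N i"
      using banach i by blast
    have xiE: "x i \<in> E i"
      using linf_sum_component[OF x(1) i] .
    define u where "u = inverse (N i (x i)) *\<^sub>R x i"
    have u: "u \<in> unit_sphere (E i) (N i)"
      using xi xiE \<delta> Ei.norm_scale[OF xiE] subspace_scale[OF Ei.subspace_carrier xiE]
      by (simp add: u_def unit_sphere_def)
    obtain f where f: "f \<in> unit_sphere (dual_space (E i) (N i)) (dual_norm (E i) (N i))"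
      and uf: "u \<in> slice (E i) (N i) f \<delta>"
      and sphere: "\<And>y. y \<in> unit_sphere (E i) (N i) \<Longrightarrow>
        \<exists>s\<in>slice (E i) (N i) f \<delta>. \<exists>t\<in>slice (E i) (N i) f \<delta>. N i (y - s) + N i (y + t) < 2 + \<delta>"
      using GL[OF i] u \<delta>(1) unfolding GL_space_iff by meson
    have fd: "f \<in> dual_space (E i) (N i)"
      using f by (simp add: unit_sphere_def)
    define g where "g = (\<lambda>x. if x \<in> ?L then f (x i) else 0)"
    have "g \<in> unit_sphere (dual_space ?L ?N) (dual_norm ?L ?N)"
      using coordinate_functional[where E = E and N = N, OF normed i fd] f by (simp add: g_def unit_sphere_def)
    moreover have "x \<in> slice ?L ?N g \<epsilon>"
    proof -
      have "x i = N i (x i) *\<^sub>R u"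
        using xi \<delta> by (simp add: u_def)
      moreover have "f (N i (x i) *\<^sub>R u) = N i (x i) * f u"
        using fd u by (simp add: dual_space_def unit_sphere_def)
      ultimately have "f (x i) = N i (x i) * f u"
        by simp
      moreover have "f u > 1 - \<delta>"
        using uf by (simp add: slice_def)
      ultimately have "f (x i) > (1 - \<delta>) * (1 - \<delta>)"
        using mult_strict_mono[OF xi, of "1 - \<delta>" "f u"] \<delta> xi by simp
      moreover have "(1 - \<delta>) * (1 - \<delta>) \<ge> 1 - \<epsilon>"
        using \<delta>(4) zero_le_square[of \<delta>] unfolding left_diff_distrib right_diff_distrib by linarith
      ultimately show ?thesis
        using x by (simp add: slice_def unit_ball_def g_def)
    qed
    moreover have "\<exists>s\<in>slice ?L ?N g \<epsilon>. \<exists>t\<in>slice ?L ?N g \<epsilon>. ?N (y - s) + ?N (y + t) < 2 + \<epsilon>"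
      if "y \<in> unit_sphere ?L ?N" for y
    proof -
      have y: "y \<in> ?L" "?N y = 1"
        using that by (auto simp: unit_sphere_def)
      have "y i \<in> unit_ball (E i) (N i)"
        using component_le_linf_norm[OF y(1) i] linf_sum_component[OF y(1) i] y(2)
        by (simp add: unit_ball_def)
      \<comment> \<open>Here \<open>y i\<close> may have norm below \<open>1\<close>, so the sphere
        condition is used in its extension to the ball.\<close>
      then obtain s t where st: "s \<in> slice (E i) (N i) f \<delta>" "t \<in> slice (E i) (N i) f \<delta>"
        "N i (y i - s) + N i (y i + t) < 2 + \<delta>"
        using Ei.slice_witnesses_on_ball[OF fd u sphere] by blast
      have E: "y i - s \<in> E i" "y i + t \<in> E i"
        using st(1,2) linf_sum_component[OF y(1) i]
        by (auto simp: slice_def unit_ball_def subspace_diff subspace_add Ei.subspace_carrier)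
      \<comment> \<open>The functional \<open>g\<close> sees only coordinate \<open>i\<close>, and
        the other coordinates of \<open>z\<close> already have norm at most
        \<open>1\<close>.\<close>
      have upd: "z(i := w) \<in> slice ?L ?N g \<epsilon>"
        if "z \<in> ?L" "?N z = 1" "w \<in> slice (E i) (N i) f \<delta>" for z w
      proof -
        have w: "w \<in> E i" "N i w \<le> 1" "f w > 1 - \<epsilon>"
          using that(3) \<delta>(2) by (auto simp: slice_def unit_ball_def)
        have le: "N j ((z(i := w)) j) \<le> 1" if "j \<in> I" for j
          using component_le_linf_norm[OF \<open>z \<in> ?L\<close> that] \<open>?N z = 1\<close> w by simp
        have "z(i := w) \<in> ?L"
          using \<open>z \<in> ?L\<close> le w i by (intro linf_sumI[where c = 1]) (auto simp: linf_sum_def)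
        moreover have "?N (z(i := w)) \<le> 1"
          using le by (intro linf_norm_le) auto
        ultimately show ?thesis
          using w by (simp add: slice_def unit_ball_def g_def)
      qed
      have "y(i := s) \<in> slice ?L ?N g \<epsilon>"
        using upd[OF y st(1)] .
      \<comment> \<open>Starting from \<open>- y\<close> makes the sum with \<open>y\<close> vanish
        off \<open>i\<close>, just as \<open>y - y(i := s)\<close> does.\<close>
      moreover have "(- y)(i := t) \<in> slice ?L ?N g \<epsilon>"
        using upd[OF _ _ st(2)] y subspace_neg[OF L.subspace_carrier y(1)] L.norm_uminus[OF y(1)]
        by simp
      moreover have "?N (y - y(i := s)) \<le> N i (y i - s)"
        using Ei.norm_nonneg[OF E(1)] normed_space_on.norm_zero[OF normed]
        by (intro linf_norm_le) auto
      moreover have "?N (y + (- y)(i := t)) \<le> N i (y i + t)"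
        using Ei.norm_nonneg[OF E(2)] normed_space_on.norm_zero[OF normed]
        by (intro linf_norm_le) auto
      ultimately show ?thesis
        using st(3) \<delta>(2) by (intro bexI[of _ "y(i := s)"] bexI[of _ "(- y)(i := t)"]) auto
    qed
    ultimately show ?thesis
      by blast
  qed
  then show ?thesis
    using L.banach_space_on_axioms unfolding GL_space_iff by blast
qed

section \<open>Separable subspaces and their coordinate projections\<close>

text \<open>Projections do not increase distances. Continuity is what carries separability of a
  subspace to its coordinate images.\<close>

lemma continuous_map_linf_component:
  assumes normed: "\<And>i. i \<in> I \<Longrightarrow> normed_space_on (E i) (N i)" and i: "i \<in> I"
  shows "continuous_map (norm_topology (linf_sum I E N) (linf_norm I N)) (norm_topology (E i) (N i))
    (\<lambda>x. x i)"
proof -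
  let ?L = "linf_sum I E N" and ?N = "linf_norm I N"
  interpret L: normed_space_on ?L ?N
    using normed_space_on_linf_sum normed by blast
  have le: "norm_dist (E i) (N i) (x i) (y i) \<le> norm_dist ?L ?N x y" if "x \<in> ?L" "y \<in> ?L" for x y
    using component_le_linf_norm[OF subspace_diff[OF L.subspace_carrier that] i]
      linf_sum_component[OF that(1) i] linf_sum_component[OF that(2) i] that
    by (simp add: norm_dist_def)
  have "(\<lambda>x. x i) ` ?L \<subseteq> E i"
    using linf_sum_component[OF _ i] by blast
  moreover have "\<exists>\<delta>>0. \<forall>y. y \<in> ?L \<and> norm_dist ?L ?N x y < \<delta> \<longrightarrow> norm_dist (E i) (N i) (x i) (y i) < \<epsilon>"
    if "x \<in> ?L" "\<epsilon> > 0" for x \<epsilon>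
    using le[OF that(1)] that(2) le_less_trans by blast
  ultimately show ?thesis
    unfolding norm_topology_def
      Metric_space.metric_continuous_map[OF L.Metric_space_norm_dist
        normed_space_on.Metric_space_norm_dist[OF normed[OF i]]]
    by blast
qed

theorem proposition3p14:
  fixes \<Lambda> :: "'i set"
    and E :: "'i \<Rightarrow> 'a::real_vector set"
    and N :: "'i \<Rightarrow> 'a \<Rightarrow> real"
  assumes "\<And>i. i \<in> \<Lambda> \<Longrightarrow> local_GL_space (E i) (N i)"
  shows "local_GL_space (linf_sum \<Lambda> E N) (linf_norm \<Lambda> N)"
proof -
  let ?L = "linf_sum \<Lambda> E N" and ?N = "linf_norm \<Lambda> N"
  have banach: "banach_space_on (E i) (N i)" if "i \<in> \<Lambda>" for i
    using assms[OF that] by (simp add: local_GL_space_def)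
  then have normed: "normed_space_on (E i) (N i)" if "i \<in> \<Lambda>" for i
    using that by (simp add: banach_space_on_def)
  interpret L: banach_space_on ?L ?N
    using banach_space_on_linf_sum banach by blast
  have "\<exists>Y. subspace Y \<and> closedin (norm_topology ?L ?N) Y \<and> GL_space Y ?N \<and> X \<subseteq> Y \<and> Y \<subseteq> ?L"
    if X: "subspace X" "X \<subseteq> ?L" "separable_space (subtopology (norm_topology ?L ?N) X)" for X
  proof -
    have "\<exists>Y. GL_space Y (N i) \<and> (\<lambda>x. x i) ` X \<subseteq> Y \<and> Y \<subseteq> E i" if i: "i \<in> \<Lambda>" for i
    proof -
      have sub: "(\<lambda>x. x i) ` X \<subseteq> E i"
        using X(2) linf_sum_component i by fastforce
      have "linear (\<lambda>x :: 'i \<Rightarrow> 'a. x i)"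
        by (auto intro!: linearI simp: scaleR_fun_apply)
      then have "subspace ((\<lambda>x. x i) ` X)"
        using X(1) by (rule linear_subspace_image)
      moreover have "separable_space (subtopology (norm_topology (E i) (N i)) ((\<lambda>x. x i) ` X))"
      proof (rule separable_space_continuous_map_image[OF X(3)])
        show "continuous_map (subtopology (norm_topology ?L ?N) X)
            (subtopology (norm_topology (E i) (N i)) ((\<lambda>x. x i) ` X)) (\<lambda>x. x i)"
          using continuous_map_linf_component[where N = N and E = E, OF normed i]
          by (auto simp: continuous_map_in_subtopology intro: continuous_map_from_subtopology)
        show "(\<lambda>x. x i) ` topspace (subtopology (norm_topology ?L ?N) X) =
            topspace (subtopology (norm_topology (E i) (N i)) ((\<lambda>x. x i) ` X))"
          using X(2) sub normed_space_on.topspace_norm_topology[OF normed[OF i]]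
          by (simp add: L.topspace_norm_topology Int_absorb1)
      qed
      ultimately show ?thesis
        using assms[OF i] sub unfolding local_GL_space_def by blast
    qed
    then obtain Y where Y: "\<And>i. i \<in> \<Lambda> \<Longrightarrow> GL_space (Y i) (N i)"
      "\<And>i. i \<in> \<Lambda> \<Longrightarrow> (\<lambda>x. x i) ` X \<subseteq> Y i" "\<And>i. i \<in> \<Lambda> \<Longrightarrow> Y i \<subseteq> E i"
      by metis
    \<comment> \<open>The required \<open>Y\<close> is the sum of the chosen subspaces with the
      original norms. Being a GL-space it is complete, hence closed in the whole sum.\<close>
    have GL: "GL_space (linf_sum \<Lambda> Y N) ?N"
      using Y(1) by (rule GL_space_linf_sum)
    then have "banach_space_on (linf_sum \<Lambda> Y N) ?N"
      by (simp add: GL_space_def)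
    moreover have "X \<subseteq> linf_sum \<Lambda> Y N" "linf_sum \<Lambda> Y N \<subseteq> ?L"
      using X(2) Y(2,3) by (force simp: linf_sum_def)+
    ultimately show ?thesis
      using GL L.complete_subspace_closedin normed_space_on.subspace_carrier
      unfolding banach_space_on_def by blast
  qed
  then show ?thesis
    using L.banach_space_on_axioms by (auto simp: local_GL_space_def)
qed

end
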